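(* For every integer $n\ge 1$, $$p(n)=S_1(n)+S_2(n)+S_3(n)+\cdots+S_{\lfloor\sqrt n\rfloor}(n),$$ where $p(n)$ is the number of partitions of $n$ and the quantities $S_m(n)$, $1\le m\le\lfloor\sqrt n\rfloor$, are the explicit nested finite sums defined in the context.
   Context: $p(n)$ denotes the number of ways of writing the integer $n$ as a sum of positive integers, where the order of addends is not important. The quantities $S_m(n)$ are defined as follows. $S_1(n)=n$. $S_2(n)=\sum_{i=1}^{\lfloor (n-2)/2\rfloor} i\,\bigl(n-3-2(i-1)\bigr)$. $S_3(n)=\sum_{j=1}^{\lfloor (n-6)/3\rfloor} S_{3j}(n)$, where $$S_{3j}(n)=j\sum_{i=1}^{\lfloor (n-7-3(j-1))/2\rfloor} i\,\bigl(n-8-2(i-1)-3(j-1)\bigr).$$ $S_4(n)=\sum_{k=1}^{\lfloor (n-12)/4\rfloor}\ \sum_{j=1}^{\lfloor (n-13-4(k-1))/3\rfloor} S_{4kj}(n)$, where $$S_{4kj}(n)=kj\sum_{i=1}^{\lfloor (n-14-3(j-1)-4(k-1))/2\rfloor} i\,\bigl(n-15-2(i-1)-3(j-1)-4(k-1)\bigr).$$ In general, for $m\ge 2$, use summation indices $a_m,a_{m-1},\dots,a_3,a_2$ (so $a_2=i$, $a_3=j$, $a_4=k$, and so on), and let $$S_m(n)=\sum_{a_m=1}^{U_m}\ \sum_{a_{m-1}=1}^{U_{m-1}}\cdots\sum_{a_3=1}^{U_3}\ \sum_{a_2=1}^{U_2}\ a_m a_{m-1}\cdots a_3 a_2\,\Bigl(n-(m^2-1)-\sum_{t=2}^{m}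 t\,(a_t-1)\Bigr),$$ where for $2\le l\le m$ the upper limit $U_l$ depends on $n$, $m$ and the outer indices $a_{l+1},\dots,a_m$ by $$U_l=\left\lfloor \frac{n-(m^2-l)-\sum_{t=l+1}^{m} t\,(a_t-1)}{l}\right\rfloor .$$ For $m=2,3,4$ this gives the formulas displayed above. A sum whose upper limit is smaller than its lower limit is empty and equals $0$. *)

theory Defs
  imports Complex_Main "HOL-Library.Multiset"
begin

definition num_partitions :: "nat \<Rightarrow> nat" where
  "num_partitions n = card {M :: nat multiset. (\<forall>k \<in># M. 0 < k) \<and> sum_mset M = n}"

text \<open>
  An assignment \<open>a :: nat \<Rightarrow> int\<close> gives the values of the summation indices \<open>a 2, \<dots>, a m\<close>.
  Only \<open>a (l + 1), \<dots>, a m\<close> occur in the upper limit of the index \<open>a l\<close>.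
  All arithmetic is on \<open>int\<close>, so no subtraction is truncated and \<open>div\<close> is the floor
  of the quotient also for a negative numerator.
\<close>

definition upper_limit :: "int \<Rightarrow> nat \<Rightarrow> nat \<Rightarrow> (nat \<Rightarrow> int) \<Rightarrow> int" where
  "upper_limit n m l a =
     (n - ((int m)\<^sup>2 - int l) - (\<Sum>t = l + 1..m. int t * (a t - 1))) div int l"

definition summand :: "int \<Rightarrow> nat \<Rightarrow> (nat \<Rightarrow> int) \<Rightarrow> int" where
  "summand n m a =
     (\<Prod>t = 2..m. a t) * (n - ((int m)\<^sup>2 - 1) - (\<Sum>t = 2..m. int t * (a t - 1)))"

text \<open>
  \<open>nested_sum n m d a\<close> consists of the \<open>d\<close> innermost summations, over the indices
  \<open>a (d + 1), \<dots>, a 2\<close> from the outside in; the indices further out have the values given by \<open>a\<close>.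
\<close>

primrec nested_sum :: "int \<Rightarrow> nat \<Rightarrow> nat \<Rightarrow> (nat \<Rightarrow> int) \<Rightarrow> int" where
  "nested_sum n m 0 a = summand n m a"
| "nested_sum n m (Suc d) a =
     (\<Sum>x = 1..upper_limit n m (d + 2) a. nested_sum n m d (a(d + 2 := x)))"

text \<open>
  The initial assignment below is irrelevant, since each of \<open>a m, \<dots>, a 2\<close> is bound by a
  summation before it is used. Only \<open>m \<ge> 1\<close> is meaningful.
\<close>

definition S_sum :: "nat \<Rightarrow> int \<Rightarrow> int" where
  "S_sum m n = (if m = 1 then n else nested_sum n m (m - 1) (\<lambda>_. 0))"

lemma S_sum_2: "S_sum 2 n = (\<Sum>i = 1..(n - 2) div 2. i * (n - 3 - 2 * (i - 1)))"
  by (simp add: S_sum_def numeral_2_eq_2 upper_limit_def summand_def)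

lemma S_sum_3:
  "S_sum 3 n =
     (\<Sum>j = 1..(n - 6) div 3.
        j * (\<Sum>i = 1..(n - 7 - 3 * (j - 1)) div 2. i * (n - 8 - 2 * (i - 1) - 3 * (j - 1))))"
proof -
  have eq: "{2..3} = {2, 3 :: nat}" "{Suc (Suc (Suc 0))..3} = {3}" by auto
  have "S_sum 3 n = nested_sum n 3 (Suc (Suc 0)) (\<lambda>_. 0)"
    by (simp add: S_sum_def numeral_2_eq_2)
  also have "\<dots> =
     (\<Sum>j = 1..(n - 6) div 3.
        j * (\<Sum>i = 1..(n - 7 - 3 * (j - 1)) div 2. i * (n - 8 - 2 * (i - 1) - 3 * (j - 1))))"
    by (simp add: upper_limit_def summand_def eq sum_distrib_left algebra_simps)
  finally show ?thesis .
qed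

lemma S_sum_4:
  "S_sum 4 n =
     (\<Sum>k = 1..(n - 12) div 4. \<Sum>j = 1..(n - 13 - 4 * (k - 1)) div 3.
        k * j * (\<Sum>i = 1..(n - 14 - 3 * (j - 1) - 4 * (k - 1)) div 2.
                   i * (n - 15 - 2 * (i - 1) - 3 * (j - 1) - 4 * (k - 1))))"
proof -
  have eq: "{2..4} = {2, 3, 4 :: nat}" 
    "{Suc (Suc (Suc 0))..4} = {3, 4}" "{Suc (Suc (Suc (Suc 0)))..4} = {4}" by auto
  have "S_sum 4 n = nested_sum n 4 (Suc (Suc (Suc 0))) (\<lambda>_. 0)"
    by (simp add: S_sum_def numeral_3_eq_3)
  also have "\<dots> =
     (\<Sum>k = 1..(n - 12) div 4. \<Sum>j = 1..(n - 13 - 4 * (k - 1)) div 3.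
        k * j * (\<Sum>i = 1..(n - 14 - 3 * (j - 1) - 4 * (k - 1)) div 2.
                   i * (n - 15 - 2 * (i - 1) - 3 * (j - 1) - 4 * (k - 1))))"
    by (simp add: upper_limit_def summand_def eq sum_distrib_left algebra_simps)
  finally show ?thesis .
qed

end

theory Submission
  imports Defs "HOL-Computational_Algebra.Formal_Power_Series"
begin

text \<open>
  The formula counts partitions by the side \<open>m\<close> of their Durfee square, the largest square
  that fits into the Young diagram. What remains to the right of the square, read by columns, and below
  it, read by rows, are two partitions into parts of size at most \<open>m\<close>, of total size \<open>n - m\<^sup>2\<close>; so with
  \<open>P\<^sub>m = \<Prod>t = 1..m. 1 / (1 - q ^ t)\<close> the number of partitions with Durfee square of side \<open>m\<close>
  is the coefficient of \<open>q ^ (n - m\<^sup>2)\<close> in \<open>P\<^sub>m\<^sup>2\<close>. That coefficient is \<open>S\<^sub>m(n)\<close>: since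
  \<open>1 / (1 - q ^ t)\<^sup>2 = \<Sum>a \<ge> 1. a * q ^ (t * (a - 1))\<close>, it is the sum of \<open>a\<^sub>1 \<cdots> a\<^sub>m\<close> over all
  \<open>a\<^sub>1, \<dots>, a\<^sub>m \<ge> 1\<close> with \<open>\<Sum>t. t * (a\<^sub>t - 1) = n - m\<^sup>2\<close>. Solving for \<open>a\<^sub>1\<close> gives the last factor
  of the summand, and the upper limits say that the remainder stays nonnegative.

  The Durfee decomposition is derived with generating functions, not by cutting up diagrams:
  \<open>durfee_rectangle_identity\<close> is a limiting form of the q-Vandermonde identity with a
  short inductive proof, and \<open>durfee_square_identity_nth\<close> is its coefficient of \<open>q ^ n\<close>, in which
  a truncation parameter disappears. The other two ingredients are
  \<open>num_partitions_eq_parts_gf_nth\<close>, which identifies \<open>p(n)\<close> with a coefficient of \<open>P\<^sub>n\<close>, and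
  \<open>nested_sum_eq_parts_gf_nth\<close>, which evaluates the nested sums from the inside out.
\<close>

unbundle fps_syntax

section \<open>Geometric series and their squares\<close>

text \<open>
  The series \<open>1 / (1 - q ^ t)\<close> for \<open>t > 0\<close>, given by its coefficients so that everything
  stays in the integral domain of power series over the integers.
\<close>

definition geom_fps :: "nat \<Rightarrow> int fps" where
  "geom_fps t = Abs_fps (\<lambda>n. if t dvd n then 1 else 0)"

lemma one_minus_X_power_mult_nth:
  fixes F :: "'a :: comm_ring_1 fps"
  shows "((1 - fps_X ^ t) * F) $ n = F $ n - (if n < t then 0 else F $ (n - t))"
  by (simp add: left_diff_distrib fps_X_power_mult_nth)

lemma one_minus_X_power_mult_geom_fps:
  assumes "t > 0"
  shows "(1 - fps_X ^ t) * geom_fps t = 1"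
proof (rule fps_ext)
  fix n
  show "((1 - fps_X ^ t) * geom_fps t) $ n = 1 $ n"
    using assms
    by (auto simp: one_minus_X_power_mult_nth geom_fps_def dvd_minus_self dvd_imp_le)
qed

text \<open>
  The weights \<open>a\<^sub>t\<close> in the nested sums come from this square: \<open>n = t * (a - 1)\<close> has the
  coefficient \<open>a\<close>.
\<close>

lemma geom_fps_power2_nth:
  assumes "t > 0"
  shows "(geom_fps t ^ 2) $ n = (if t dvd n then int (n div t) + 1 else 0)"
proof -
  \<comment> \<open>Multiplying the claimed square by \<open>1 - q ^ t\<close> takes differences of coefficients that are
      \<open>t\<close> apart, which gives back the geometric series.\<close>
  define D where "D = Abs_fps (\<lambda>n. if t dvd n then int (n div t) + 1 else 0)"
  have D: "(1 - fps_X ^ t) * D = geom_fps t"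
  proof (rule fps_ext)
    fix n
    have "int (n div t) = int ((n - t) div t) + 1" if "t \<le> n"
      using that assms by (simp add: le_div_geq)
    then show "((1 - fps_X ^ t) * D) $ n = geom_fps t $ n"
      using assms
      by (auto simp: one_minus_X_power_mult_nth D_def geom_fps_def dvd_minus_self dvd_imp_le)
  qed
  have "geom_fps t ^ 2 = geom_fps t * ((1 - fps_X ^ t) * D)"
    by (simp add: D power2_eq_square)
  also have "\<dots> = ((1 - fps_X ^ t) * geom_fps t) * D"
    by (simp add: mult_ac)
  also have "\<dots> = D"
    using assms by (simp add: one_minus_X_power_mult_geom_fps)
  finally show ?thesis
    by (simp add: D_def)
qed

text \<open>One level of the nested sums, with \<open>y = a\<^sub>t - 1\<close>.\<close>

lemma mult_geom_fps_power2_nth: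
  assumes "t > 0"
  shows "(F * geom_fps t ^ 2) $ n = (\<Sum>y\<le>n div t. (int y + 1) * F $ (n - t * y))"
proof -
  have "(F * geom_fps t ^ 2) $ n = (\<Sum>i = 0..n. (geom_fps t ^ 2) $ i * F $ (n - i))"
    by (subst mult.commute) (rule fps_mult_nth)
  also have "\<dots> = (\<Sum>i \<in> (\<lambda>y. t * y) ` {..n div t}. (geom_fps t ^ 2) $ i * F $ (n - i))"
  proof (rule sum.mono_neutral_right)
    show "(\<lambda>y. t * y) ` {..n div t} \<subseteq> {0..n}"
    proof clarsimp
      fix y assume "y \<le> n div t"
      then show "t * y \<le> n"
        using assms by (simp add: less_eq_div_iff_mult_less_eq mult.commute)
    qed
    show "\<forall>i \<in> {0..n} - (\<lambda>y. t * y) ` {..n div t}. (geom_fps t ^ 2) $ i * F $ (n - i) = 0"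
    proof
      fix i assume i: "i \<in> {0..n} - (\<lambda>y. t * y) ` {..n div t}"
      have "\<not> t dvd i"
      proof
        assume "t dvd i"
        then have "i = t * (i div t)" by simp
        moreover have "i div t \<le> n div t" using i by (simp add: div_le_mono)
        ultimately show False using i by blast
      qed
      then show "(geom_fps t ^ 2) $ i * F $ (n - i) = 0"
        using assms by (simp add: geom_fps_power2_nth)
    qed
  qed simp
  also have "\<dots> = (\<Sum>y\<le>n div t. (int y + 1) * F $ (n - t * y))"
    using assms by (subst sum.reindex) (auto simp: inj_on_def geom_fps_power2_nth)
  finally show ?thesis .
qed

section \<open>Partitions into bounded parts\<close>

text \<open>The generating function of the partitions into parts of size at most \<open>N\<close>.\<close>

definition parts_gf :: "nat \<Rightarrow> int fps" where
  "parts_gf N = (\<Prod>t = 1..N. geom_fps t)"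

lemma parts_gf_0 [simp]: "parts_gf 0 = 1"
  by (simp add: parts_gf_def)

lemma parts_gf_Suc: "parts_gf (Suc N) = parts_gf N * geom_fps (Suc N)"
  by (simp add: parts_gf_def)

lemma one_minus_X_power_mult_parts_gf:
  "(1 - fps_X ^ Suc N) * parts_gf (Suc N) = parts_gf N"
proof -
  have "(1 - fps_X ^ Suc N) * parts_gf (Suc N)
      = parts_gf N * ((1 - fps_X ^ Suc N) * geom_fps (Suc N))"
    by (simp add: parts_gf_Suc mult_ac del: power_Suc)
  then show ?thesis
    by (simp add: one_minus_X_power_mult_geom_fps del: power_Suc)
qed

lemma parts_gf_mult_prod:
  "B \<le> A \<Longrightarrow> parts_gf A * (\<Prod>t \<in> {B<..A}. 1 - fps_X ^ t) = parts_gf B"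
proof (induction A rule: dec_induct)
  case (step A)
  have "{B<..Suc A} = insert (Suc A) {B<..A}"
    using step.hyps by auto
  then have "parts_gf (Suc A) * (\<Prod>t \<in> {B<..Suc A}. 1 - fps_X ^ t)
      = ((1 - fps_X ^ Suc A) * parts_gf (Suc A)) * (\<Prod>t \<in> {B<..A}. 1 - fps_X ^ t)"
    by (simp add: mult_ac del: power_Suc)
  then show ?case
    using step.IH by (simp only: one_minus_X_power_mult_parts_gf)
qed simp

text \<open>
  Factors \<open>1 - q ^ t\<close> with large \<open>t\<close> do not affect the low coefficients; this removes the
  truncation parameter from the Durfee identity.
\<close>

lemma mult_prod_one_minus_X_power_nth:
  fixes F :: "'a :: comm_ring_1 fps"
  assumes "finite T" "\<And>t. t \<in> T \<Longrightarrow> n < t"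
  shows "(F * (\<Prod>t \<in> T. 1 - fps_X ^ t)) $ n = F $ n"
  using assms
proof (induction T rule: finite_induct)
  case (insert t T)
  have "F * (\<Prod>t \<in> insert t T. 1 - fps_X ^ t)
      = (1 - fps_X ^ t) * (F * (\<Prod>t \<in> T. 1 - fps_X ^ t))"
    using insert.hyps by (simp add: mult_ac)
  then show ?case
    using insert by (simp only: one_minus_X_power_mult_nth) simp
qed simp

section \<open>The Durfee identity\<close>

text \<open>
  Divided by \<open>parts_gf A\<close>, this says \<open>\<Sum>m. q ^ (m * (m + k)) * [A, m] * P (m + k) = P (A + k)\<close>
  with Gaussian binomials \<open>[A, m]\<close>: a partition with parts at most \<open>A + k\<close> is split by the
  largest \<open>m\<close> times \<open>m + k\<close> rectangle in its diagram. The free offset \<open>k\<close> makes the induction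
  work. The step uses the Pascal rule for \<open>[A + 1, m]\<close>, in the form
  \<open>1 - q ^ (A + 1) = q ^ m * (1 - q ^ (A + 1 - m)) + (1 - q ^ m)\<close>. As
  \<open>P (m + k) = (1 - q ^ (m + k + 1)) * P (m + k + 1)\<close>, the part with \<open>[A, m]\<close> is the term of
  the induction hypothesis for \<open>k + 1\<close> minus a correction, and this correction is the part
  with \<open>[A, m - 1]\<close> for the next \<open>m\<close>.
\<close>

lemma durfee_rectangle_identity:
  "(\<Sum>m\<le>A. fps_X ^ (m * (m + k)) * parts_gf m * parts_gf (m + k) * parts_gf (A - m))
     = parts_gf A * parts_gf (A + k)"
proof (induction A arbitrary: k)
  case (Suc A)
  define c :: "nat \<Rightarrow> int fps" where "c j = 1 - fps_X ^ j" for j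
  have c_Suc: "c (Suc N) * parts_gf (Suc N) = parts_gf N" for N
    unfolding c_def by (rule one_minus_X_power_mult_parts_gf)
  define T where "T m = fps_X ^ (m * (m + k)) * parts_gf m * parts_gf (m + k)
    * parts_gf (Suc A - m)" for m
  define W where "W m = fps_X ^ (m * (m + Suc k)) * parts_gf m * parts_gf (m + Suc k)
    * parts_gf (A - m)" for m
  define V where "V m = fps_X ^ (Suc m * (Suc m + k)) * parts_gf m * parts_gf (Suc m + k)
    * parts_gf (A - m)" for m
  \<comment> \<open>The Pascal rule; the two parts below cancel the last factor of \<open>parts_gf (Suc A - m)\<close> or of
      \<open>parts_gf m\<close> respectively.\<close>
  have split: "c (Suc A) = fps_X ^ m * c (Suc A - m) + c m" if "m \<le> Suc A" for m
    using that by (simp add: c_def algebra_simps power_add[symmetric] del: power_Suc)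
  have long: "fps_X ^ m * c (Suc A - m) * T m = W m - V m" if "m \<le> A" for m
  proof -
    have "fps_X ^ m * c (Suc A - m) * T m
        = fps_X ^ (m + m * (m + k)) * parts_gf m * parts_gf (m + k)
          * (c (Suc (A - m)) * parts_gf (Suc (A - m)))"
      using that by (simp add: T_def Suc_diff_le power_add mult_ac)
    also have "\<dots> = fps_X ^ (m * (m + Suc k)) * parts_gf m
          * (c (Suc (m + k)) * parts_gf (Suc (m + k))) * parts_gf (A - m)"
      unfolding c_Suc by (simp add: mult_ac)
    also have "\<dots> = W m - fps_X ^ (m * (m + Suc k)) * fps_X ^ Suc (m + k)
          * parts_gf m * parts_gf (Suc (m + k)) * parts_gf (A - m)"
      by (simp add: W_def c_def algebra_simps del: power_Suc)
    also have "fps_X ^ (m * (m + Suc k)) * fps_X ^ Suc (m + k)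
        = (fps_X :: int fps) ^ (Suc m * (Suc m + k))"
      unfolding power_add[symmetric]
      by (rule arg_cong[where f = "power fps_X"]) (simp add: algebra_simps)
    finally show ?thesis
      by (simp add: V_def)
  qed
  have short: "c (Suc m) * T (Suc m) = V m" for m
  proof -
    have "c (Suc m) * T (Suc m) = fps_X ^ (Suc m * (Suc m + k))
        * (c (Suc m) * parts_gf (Suc m)) * parts_gf (Suc m + k) * parts_gf (A - m)"
      unfolding T_def by (simp add: mult_ac del: power_Suc)
    then show ?thesis
      by (simp only: c_Suc V_def)
  qed
  have "c (Suc A) * (\<Sum>m\<le>Suc A. T m)
      = (\<Sum>m\<le>Suc A. fps_X ^ m * c (Suc A - m) * T m) + (\<Sum>m\<le>Suc A. c m * T m)"
    unfolding sum_distrib_left sum.distrib[symmetric]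
    by (intro sum.cong refl, subst split) (simp_all add: ring_distribs)
  \<comment> \<open>Each of the two sums loses one boundary term because \<open>c 0 = 0\<close>: the first at \<open>m = Suc A\<close>,
      the second at \<open>m = 0\<close>.\<close>
  also have "(\<Sum>m\<le>Suc A. fps_X ^ m * c (Suc A - m) * T m) = (\<Sum>m\<le>A. W m - V m)"
    using long by (simp add: c_def)
  also have "(\<Sum>m\<le>Suc A. c m * T m) = (\<Sum>m\<le>A. V m)"
    unfolding sum.atMost_Suc_shift short by (simp add: c_def)
  also have "(\<Sum>m\<le>A. W m - V m) + (\<Sum>m\<le>A. V m) = (\<Sum>m\<le>A. W m)"
    by (simp add: sum_subtractf)
  also have "\<dots> = parts_gf A * parts_gf (A + Suc k)"
    unfolding W_def by (rule Suc.IH)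
  also have "\<dots> = c (Suc A) * (parts_gf (Suc A) * parts_gf (Suc A + k))"
    unfolding c_Suc[of A, symmetric] by (simp add: mult_ac)
  finally have "c (Suc A) * (\<Sum>m\<le>Suc A. T m)
      = c (Suc A) * (parts_gf (Suc A) * parts_gf (Suc A + k))" .
  moreover have "c (Suc A) \<noteq> 0"
  proof
    assume "c (Suc A) = 0"
    then have "c (Suc A) $ 0 = 0" by simp
    then show False by (simp add: c_def)
  qed
  ultimately show ?case
    unfolding T_def[symmetric] by (simp only: mult_cancel_left) simp
qed simp

text \<open>
  In the case \<open>k = 0\<close>, \<open>A = n\<close> of the rectangle identity, multiplication by \<open>1 / parts_gf n\<close>
  turns \<open>parts_gf (n - m)\<close> into a product of factors \<open>1 - q ^ t\<close> with \<open>t > n - m \<ge> n - m\<^sup>2\<close>,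
  which the relevant coefficient does not see.
\<close>

lemma durfee_square_identity_nth:
  "parts_gf n $ n = (\<Sum>m | m\<^sup>2 \<le> n. (parts_gf m ^ 2) $ (n - m\<^sup>2))"
proof -
  define Q :: "int fps" where "Q = (\<Prod>t \<in> {0<..n}. 1 - fps_X ^ t)"
  have Q: "parts_gf n * Q = 1"
    using parts_gf_mult_prod[of 0 n] by (simp add: Q_def)
  have summand: "(fps_X ^ (m * m) * parts_gf m * parts_gf m * parts_gf (n - m) * Q) $ n
      = (if m\<^sup>2 \<le> n then (parts_gf m ^ 2) $ (n - m\<^sup>2) else 0)" if "m \<le> n" for m
  proof -
    define R :: "int fps" where "R = (\<Prod>t \<in> {n - m<..n}. 1 - fps_X ^ t)"
    have "parts_gf (n - m) * Q = parts_gf n * Q * R"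
      unfolding R_def by (subst parts_gf_mult_prod[of "n - m" n, symmetric]) (simp_all add: mult_ac)
    then have "fps_X ^ (m * m) * parts_gf m * parts_gf m * parts_gf (n - m) * Q
        = fps_X ^ m\<^sup>2 * (parts_gf m ^ 2 * R)"
      using Q by (simp add: power2_eq_square mult.assoc)
    moreover have "(parts_gf m ^ 2 * R) $ (n - m\<^sup>2) = (parts_gf m ^ 2) $ (n - m\<^sup>2)"
    proof -
      have "m \<le> m\<^sup>2" by (simp add: power2_eq_square)
      then show ?thesis
        unfolding R_def by (intro mult_prod_one_minus_X_power_nth) auto
    qed
    ultimately show ?thesis
      by (simp add: fps_X_power_mult_nth)
  qed
  have "parts_gf n = parts_gf n * parts_gf (n + 0) * Q"
    using Q by (simp add: mult.assoc)
  also have "\<dots> = (\<Sum>m\<le>n. fps_X ^ (m * m) * parts_gf m * parts_gf m * parts_gf (n - m) * Q)"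
    using durfee_rectangle_identity[where A = n and k = 0]
    by (simp only: sum_distrib_right[symmetric] add_0_right)
  finally have "parts_gf n $ n
      = (\<Sum>m\<le>n. fps_X ^ (m * m) * parts_gf m * parts_gf m * parts_gf (n - m) * Q) $ n"
    by (rule arg_cong)
  also have "\<dots>
      = (\<Sum>m\<le>n. (fps_X ^ (m * m) * parts_gf m * parts_gf m * parts_gf (n - m) * Q) $ n)"
    by (rule fps_sum_nth)
  also have "\<dots> = (\<Sum>m\<le>n. if m\<^sup>2 \<le> n then (parts_gf m ^ 2) $ (n - m\<^sup>2) else 0)"
    by (intro sum.cong summand) auto
  also have "\<dots> = (\<Sum>m \<in> {..n} \<inter> {m. m\<^sup>2 \<le> n}. (parts_gf m ^ 2) $ (n - m\<^sup>2))"
    by (simp add: sum.inter_restrict)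
  also have "{..n} \<inter> {m. m\<^sup>2 \<le> n} = {m. m\<^sup>2 \<le> n}"
    by (auto simp: power2_eq_square intro: order_trans[OF le_square])
  finally show ?thesis .
qed

section \<open>Counting partitions\<close>

text \<open>
  A partition with parts at most \<open>N + 1\<close> either avoids the part \<open>N + 1\<close> or arises by adding
  that part to a smaller partition of the same kind. This is the recurrence that
  \<open>(1 - q ^ (N + 1)) * parts_gf (N + 1) = parts_gf N\<close> gives for the coefficients. Finiteness is
  proved along with the count because \<open>card\<close> of a union needs it.
\<close>

lemma card_bounded_partitions:
  "finite {M :: nat multiset. set_mset M \<subseteq> {1..N} \<and> sum_mset M = n} \<and>
   int (card {M :: nat multiset. set_mset M \<subseteq> {1..N} \<and> sum_mset M = n}) = parts_gf N $ n"
  (is "finite (?Par N n) \<and> int (card (?Par N n)) = _")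
proof (induction N arbitrary: n)
  case 0
  have "?Par 0 n = (if n = 0 then {{#}} else {})" by auto
  then show ?case by simp
next
  case (Suc N)
  show ?case
  proof (induction n rule: less_induct)
    case (less n)
    define Big where "Big = (if n < Suc N then {} else add_mset (Suc N) ` ?Par (Suc N) (n - Suc N))"
    have split: "?Par (Suc N) n = ?Par N n \<union> Big"
    proof (intro equalityI subsetI)
      fix M assume M: "M \<in> ?Par (Suc N) n"
      show "M \<in> ?Par N n \<union> Big"
      proof (cases "Suc N \<in># M")
        case True
        then obtain M' where "M = add_mset (Suc N) M'"
          by (metis multi_member_split)
        then show ?thesis using M by (auto simp: Big_def)
      next
        case False
        have "set_mset M \<subseteq> {1..N}"
        proof
          fix k assume "k \<in># M"
          then have "k \<in> {1..Suc N}" "k \<noteq> Suc N"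
            using M False by auto
          then show "k \<in> {1..N}" by auto
        qed
        then show ?thesis using M by simp
      qed
    qed (auto simp: Big_def split: if_splits)
    have Big: "finite Big \<and> int (card Big)
        = (if n < Suc N then 0 else parts_gf (Suc N) $ (n - Suc N))"
    proof (cases "n < Suc N")
      case False
      have "card (add_mset (Suc N) ` X) = card X" for X :: "nat multiset set"
        by (intro card_image inj_onI) simp
      then show ?thesis
        using False less.IH[of "n - Suc N"] by (simp add: Big_def)
    qed (simp add: Big_def)
    have "Suc N \<in># M" if "M \<in> Big" for M
      using that by (auto simp: Big_def split: if_splits)
    moreover have "Suc N \<notin># M" if "M \<in> ?Par N n" for M
      using that by force
    ultimately have "?Par N n \<inter> Big = {}"
      by blast
    then have "int (card (?Par (Suc N) n)) = int (card (?Par N n)) + int (card Big)"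
      using Suc[of n] Big unfolding split by (simp add: card_Un_disjoint)
    also have "\<dots> = parts_gf N $ n + (if n < Suc N then 0 else parts_gf (Suc N) $ (n - Suc N))"
      using Suc[of n] Big by simp
    also have "\<dots> = parts_gf (Suc N) $ n"
      by (subst one_minus_X_power_mult_parts_gf[symmetric], subst one_minus_X_power_mult_nth) simp
    finally have "int (card (?Par (Suc N) n)) = parts_gf (Suc N) $ n" .
    moreover have "finite (?Par (Suc N) n)"
      using Suc[of n] Big unfolding split by blast
    ultimately show ?case by blast
  qed
qed

lemma num_partitions_eq_parts_gf_nth: "int (num_partitions n) = parts_gf n $ n"
proof -
  have "k \<le> sum_mset M" if "k \<in># M" for k and M :: "nat multiset"
    using that by (metis multi_member_split sum_mset.add_mset le_add1)
  then have "{M :: nat multiset. (\<forall>k \<in># M. 0 < k) \<and> sum_mset M = n}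
      = {M. set_mset M \<subseteq> {1..n} \<and> sum_mset M = n}"
    by (fastforce simp: Suc_le_eq)
  then show ?thesis
    using card_bounded_partitions[of n n] by (simp add: num_partitions_def)
qed

section \<open>Evaluating the nested sums\<close>

text \<open>
  The number \<open>r\<close> is what is left of \<open>n - m\<^sup>2\<close> for the \<open>d\<close> inner indices and the eliminated
  index \<open>a 1\<close>. The hypothesis that it is nonnegative is preserved by the upper limits:
  \<open>upper_limit\<close> is \<open>r div l + 1\<close>, so exactly the \<open>x \<ge> 1\<close> with \<open>l * (x - 1) \<le> r\<close> are summed
  over.
\<close>

lemma nested_sum_eq_parts_gf_nth:
  assumes "d + 1 \<le> m"
    and "n - (int m)\<^sup>2 - (\<Sum>t = d + 2..m. int t * (a t - 1)) = int r"
  shows "nested_sum n m d a = (\<Prod>t = d + 2..m. a t) * (parts_gf (d + 1) ^ 2) $ r"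
  using assms
proof (induction d arbitrary: a r)
  case 0
  \<comment> \<open>The value of the eliminated index \<open>a 1\<close>, the last factor of the summand.\<close>
  have "(parts_gf 1 ^ 2) $ r = int r + 1"
    using geom_fps_power2_nth[of 1 r] by (simp add: parts_gf_def)
  then show ?case
    using 0 by (simp add: summand_def algebra_simps numeral_2_eq_2)
next
  case (Suc d)
  define l where "l = d + 2"
  have l: "l > 0" "l \<le> m" "Suc d + 2 = l + 1" "Suc d + 1 = l" "d + 1 = l - 1"
    using Suc.prems by (auto simp: l_def)
  have indices: "{l..m} = insert l {l + 1..m}"
    using l by auto
  define p where "p = (\<Prod>t = l + 1..m. a t)"
  have r: "n - (int m)\<^sup>2 - (\<Sum>t = l + 1..m. int t * (a t - 1)) = int r"
    using Suc.prems l by simp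
  have "upper_limit n m l a = (int r + int l) div int l"
    unfolding upper_limit_def using r by (simp add: algebra_simps)
  also have "\<dots> = int (r div l) + 1"
    using l by (simp add: zdiv_int)
  finally have limit: "upper_limit n m l a = int (r div l) + 1" .
  have inner: "nested_sum n m d (a(l := int y + 1))
      = p * ((int y + 1) * (parts_gf (d + 1) ^ 2) $ (r - l * y))" if "y \<le> r div l" for y
  proof -
    have "l * y \<le> r"
      using that l by (simp add: less_eq_div_iff_mult_less_eq mult.commute)
    then have remainder: "int (r - l * y) = int r - int l * int y"
      by (simp add: of_nat_diff)
    have "(\<Sum>t = l..m. int t * ((a(l := int y + 1)) t - 1))
        = int l * int y + (\<Sum>t = l + 1..m. int t * (a t - 1))"
      unfolding indices by simp
    then have
      "n - (int m)\<^sup>2 - (\<Sum>t = l..m. int t * ((a(l := int y + 1)) t - 1)) = int (r - l * y)"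
      using r by (simp only: remainder)
    moreover have "d + 1 \<le> m"
      using Suc.prems(1) by simp
    ultimately have inner_value: "nested_sum n m d (a(l := int y + 1))
        = (\<Prod>t = l..m. (a(l := int y + 1)) t) * (parts_gf (d + 1) ^ 2) $ (r - l * y)"
      by (intro Suc.IH[folded l_def])
    have "(\<Prod>t = l..m. (a(l := int y + 1)) t) = (int y + 1) * p"
      unfolding indices p_def by simp
    then show ?thesis
      by (simp only: inner_value mult_ac)
  qed
  have "nested_sum n m (Suc d) a
      = (\<Sum>x = 1..int (r div l) + 1. nested_sum n m d (a(l := x)))"
    using limit by (simp add: l_def)
  also have "\<dots> = (\<Sum>y\<le>r div l. nested_sum n m d (a(l := int y + 1)))"
    by (rule sum.reindex_bij_witness[of _ "\<lambda>y. int y + 1" "\<lambda>x. nat (x - 1)"]) auto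
  also have "\<dots> = (\<Sum>y\<le>r div l. p * ((int y + 1) * (parts_gf (d + 1) ^ 2) $ (r - l * y)))"
    by (intro sum.cong inner) auto
  also have "\<dots> = p * (parts_gf (d + 1) ^ 2 * geom_fps l ^ 2) $ r"
    unfolding sum_distrib_left[symmetric] mult_geom_fps_power2_nth[OF l(1)] ..
  also have "parts_gf (d + 1) ^ 2 * geom_fps l ^ 2 = parts_gf (Suc d + 1) ^ 2"
    by (simp add: l_def parts_gf_Suc power_mult_distrib)
  finally show ?case
    by (simp add: p_def l_def)
qed

lemma S_sum_eq_parts_gf_nth:
  assumes "m \<ge> 1" "m\<^sup>2 \<le> n"
  shows "S_sum m (int n) = (parts_gf m ^ 2) $ (n - m\<^sup>2)"
proof -
  have "S_sum m (int n) = nested_sum (int n) m (m - 1) (\<lambda>_. 0)"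
    by (auto simp: S_sum_def summand_def)
  then show ?thesis
    using nested_sum_eq_parts_gf_nth[of "m - 1" m "int n" "\<lambda>_. 0" "n - m\<^sup>2"] assms
    by (simp add: of_nat_diff)
qed

theorem theorem1:
  fixes n :: nat
  assumes "n \<ge> 1"
  shows "int (num_partitions n) = (\<Sum>m = 1..nat \<lfloor>sqrt (real n)\<rfloor>. S_sum m (int n))"
proof -
  have le_sqrt: "m \<le> nat \<lfloor>sqrt (real n)\<rfloor> \<longleftrightarrow> m\<^sup>2 \<le> n" for m
  proof -
    have "m \<le> nat \<lfloor>sqrt (real n)\<rfloor> \<longleftrightarrow> real m \<le> sqrt (real n)"
      by (simp add: le_nat_iff le_floor_iff)
    also have "\<dots> \<longleftrightarrow> (real m)\<^sup>2 \<le> real n"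
      by (metis of_nat_0_le_iff real_le_rsqrt real_sqrt_le_iff real_sqrt_abs abs_of_nat)
    also have "\<dots> \<longleftrightarrow> m\<^sup>2 \<le> n"
      by (metis of_nat_le_iff of_nat_power)
    finally show ?thesis .
  qed
  \<comment> \<open>Only the empty partition has a Durfee square of side \<open>0\<close>, so that term vanishes for
      \<open>n \<ge> 1\<close>.\<close>
  have "{m. m\<^sup>2 \<le> n} = insert 0 {1..nat \<lfloor>sqrt (real n)\<rfloor>}"
    by (auto simp: le_sqrt)
  then have "int (num_partitions n) = (\<Sum>m = 1..nat \<lfloor>sqrt (real n)\<rfloor>. (parts_gf m ^ 2) $ (n - m\<^sup>2))"
    using assms by (simp add: num_partitions_eq_parts_gf_nth durfee_square_identity_nth)
  also have "\<dots> = (\<Sum>m = 1..nat \<lfloor>sqrt (real n)\<rfloor>. S_sum m (int n))"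
    by (intro sum.cong refl S_sum_eq_parts_gf_nth[symmetric]) (auto simp: le_sqrt)
  finally show ?thesis .
qed

end
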